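(* Let $n$ be a positive integer, let $D=\{a_1,\ldots,a_m\}$ be a $B_2$-sequence over $\mathbb{Z}_n$, and let $\ell,k$ be positive integers with $\ell k\le n$. Define the array $\mathcal{A}$ on $\mathbb{Z}^2$ by placing a dot at $(i,j)$ if and only if $a_t\equiv i\ell+j \pmod n$ for some $t$. Then $\mathcal{A}$ is a doubly periodic $\ell\times k$ DDC of period $\left(\frac{n}{\gcd(n,\ell)},n\right)$ and density $m/n$.
   Context: For an abelian group $A$, a sequence $D=\{a_1,\ldots,a_m\}$ of $m$ distinct elements of $A$ is a $B_2$-sequence over $A$ if all sums $a_{i_1}+a_{i_2}$ with $1\le i_1\le i_2\le m$ are distinct. Points $(i,j)\in\mathbb{Z}^2$ are in column $i$ and row $j$. An array of dots $\mathcal{A}$ on $\mathbb{Z}^2$ (a subset of $\mathbb{Z}^2$) is doubly periodic with period $(\eta,\kappa)$ ($\eta,\kappa$ positive integers) if $(i,j)$ is a dot iff $(i+\eta,j)$ is a dot iff $(i,j+\kappa)$ is a dot, for all $i,j$; its density is $d/(\eta\kappa)$ where $d$ is the number of dots in any $\kappa\times\eta$ sub-array. An $a\times b$ sub-array is a set $\{(i_0+i,j_0+j):0\le i\le b-1,\ 0\le j\le a-1\}$ ($a$ rows, $b$ columns). A set of dots is a DDC (distinct difference configuration) if the vectors $x-y$, over ordered pairs $(x,y)$ of distinct dots, are pairwise distinct. A doubly periodic array is a doubly periodic $a\times b$ DDC if the dots in every $a\times b$ sub-array form a DDC. *)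

theory Defs
  imports Complex_Main "HOL-Algebra.Elementary_Groups" "HOL-Number_Theory.Cong" "HOL-Library.Product_Plus"
begin

text \<open>
  Meant for an abelian group \<open>G\<close>; the sums are written multiplicatively, as in HOL-Algebra.
\<close>

definition B2_sequence :: "('a, 'b) monoid_scheme \<Rightarrow> nat \<Rightarrow> (nat \<Rightarrow> 'a) \<Rightarrow> bool" where
  "B2_sequence G m a \<longleftrightarrow>
     (\<forall>t\<in>{1..m}. a t \<in> carrier G) \<and> inj_on a {1..m} \<and>
     inj_on (\<lambda>(s, t). a s \<otimes>\<^bsub>G\<^esub> a t) {(s, t). 1 \<le> s \<and> s \<le> t \<and> t \<le> m}"

text \<open>
  A point \<open>(i, j)\<close> lies in column \<open>i\<close> and row \<open>j\<close>, whereas sub-arrays are given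
  as (number of rows) \<open>\<times>\<close> (number of columns) and periods as (horizontal, vertical).
\<close>

definition doubly_periodic :: "(int \<times> int) set \<Rightarrow> nat \<Rightarrow> nat \<Rightarrow> bool" where
  "doubly_periodic A \<eta> \<kappa> \<longleftrightarrow> 0 < \<eta> \<and> 0 < \<kappa> \<and>
     (\<forall>i j. ((i, j) \<in> A \<longleftrightarrow> (i + int \<eta>, j) \<in> A) \<and>
            ((i, j) \<in> A \<longleftrightarrow> (i, j + int \<kappa>) \<in> A))"

definition subarray :: "nat \<Rightarrow> nat \<Rightarrow> int \<Rightarrow> int \<Rightarrow> (int \<times> int) set" where
  "subarray a b i0 j0 = {(i0 + i, j0 + j) | i j. 0 \<le> i \<and> i \<le> int b - 1 \<and> 0 \<le> j \<and> j \<le> int a - 1}"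

definition DDC :: "(int \<times> int) set \<Rightarrow> bool" where
  "DDC S \<longleftrightarrow> inj_on (\<lambda>(x, y). x - y) {(x, y). x \<in> S \<and> y \<in> S \<and> x \<noteq> y}"

definition doubly_periodic_DDC :: "(int \<times> int) set \<Rightarrow> nat \<Rightarrow> nat \<Rightarrow> nat \<Rightarrow> nat \<Rightarrow> bool" where
  "doubly_periodic_DDC A a b \<eta> \<kappa> \<longleftrightarrow>
     doubly_periodic A \<eta> \<kappa> \<and> (\<forall>i0 j0. DDC (A \<inter> subarray a b i0 j0))"

text \<open>
  The density of an array of period \<open>(\<eta>, \<kappa>)\<close>; that the number \<open>d\<close> of dots
  does not depend on the chosen \<open>\<kappa> \<times> \<eta>\<close> sub-array is part of the assertion.
\<close>

definition has_density :: "(int \<times> int) set \<Rightarrow> nat \<Rightarrow> nat \<Rightarrow> real \<Rightarrow> bool" where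
  "has_density A \<eta> \<kappa> \<delta> \<longleftrightarrow>
     (\<exists>d. (\<forall>i0 j0. card (A \<inter> subarray \<kappa> \<eta> i0 j0) = d) \<and> \<delta> = real d / (real \<eta> * real \<kappa>))"

definition dot_array :: "nat \<Rightarrow> nat \<Rightarrow> nat \<Rightarrow> (nat \<Rightarrow> int) \<Rightarrow> (int \<times> int) set" where
  "dot_array n l m a = {(i, j). \<exists>t\<in>{1..m}. [a t = i * int l + j] (mod int n)}"

end

theory Submission
  imports Defs
begin

text \<open>
  The map \<open>(i, j) \<mapsto> i * l + j\<close> is additive and, as \<open>l * k \<le> n\<close>, injective modulo \<open>n\<close> on every
  \<open>l \<times> k\<close> sub-array. A repeated difference \<open>x - y = z - w\<close> of dots therefore yields equal sums
  \<open>a s + a t' = a s' + a t\<close>, which the B2 property excludes. For the density, each column has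
  exactly one dot for each \<open>a t\<close> among any \<open>n\<close> consecutive rows.
\<close>

text \<open>The group operation is addition modulo \<open>n\<close>, so the congruence is an
  equality of group sums. The B2 property only speaks of ordered index pairs, hence both pairs are
  sorted by \<open>min\<close> and \<open>max\<close>; addition being commutative, the sums do not
  change.\<close>

lemma B2_sequence_cong_sums:
  fixes n m :: nat and a :: "nat \<Rightarrow> int"
  assumes n: "0 < n" and B2: "B2_sequence (integer_mod_group n) m a"
    and st: "s \<in> {1..m}" "t \<in> {1..m}" "s' \<in> {1..m}" "t' \<in> {1..m}"
    and eq: "[a s + a t = a s' + a t'] (mod int n)"
  shows "(s = s' \<and> t = t') \<or> (s = t' \<and> t = s')"
proof -
  let ?f = "\<lambda>(s, t). (a s + a t) mod int n"
  have inj: "inj_on ?f {(s, t). 1 \<le> s \<and> s \<le> t \<and> t \<le> m}"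
    using B2 n by (simp add: B2_sequence_def mult_integer_mod_group)
  have "?f (min s t, max s t) = ?f (min s' t', max s' t')"
    using eq by (auto simp: cong_def min_def max_def add.commute)
  then have "(min s t, max s t) = (min s' t', max s' t')"
    using st by (intro inj_onD[OF inj]) auto
  then show ?thesis
    by (auto simp: min_def max_def split: if_splits)
qed

lemma subarray_iff:
  "(i, j) \<in> subarray r c i0 j0 \<longleftrightarrow> i0 \<le> i \<and> i < i0 + int c \<and> j0 \<le> j \<and> j < j0 + int r"
proof
  assume "i0 \<le> i \<and> i < i0 + int c \<and> j0 \<le> j \<and> j < j0 + int r"
  then show "(i, j) \<in> subarray r c i0 j0"
    unfolding subarray_def
    by (intro CollectI exI[of _ "i - i0"] exI[of _ "j - j0"]) auto
qed (auto simp: subarray_def)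

text \<open>With the corner moved to the origin, both values lie in \<open>{0..<int n}\<close>
  because \<open>l * k \<le> n\<close>, so congruence becomes equality. Division by \<open>l\<close>
  then recovers the column offset as quotient and the row offset as remainder.\<close>

lemma subarray_inj_mod:
  assumes lk: "l * k \<le> n"
    and x: "(i, j) \<in> subarray l k i0 j0" and y: "(i', j') \<in> subarray l k i0 j0"
    and eq: "[i * int l + j = i' * int l + j'] (mod int n)"
  shows "i = i' \<and> j = j'"
proof -
  define u v u' v' where uv: "u = i - i0" "v = j - j0" "u' = i' - i0" "v' = j' - j0"
  have bounds: "0 \<le> u" "u < int k" "0 \<le> v" "v < int l" "0 \<le> u'" "u' < int k" "0 \<le> v'" "v' < int l"
    using x y by (auto simp: subarray_iff uv)
  have small: "0 \<le> p * int l + q \<and> p * int l + q < int n"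
    if "0 \<le> p" "p < int k" "0 \<le> q" "q < int l" for p q
  proof -
    \<comment> \<open>Since \<open>q < int l\<close>, the value \<open>p * int l + q\<close> lies
      below \<open>(p + 1) * int l\<close>.\<close>
    have "(p + 1) * int l \<le> int k * int l"
      using that by (intro mult_right_mono) auto
    also have "\<dots> \<le> int n"
      using lk by (metis mult.commute of_nat_le_iff of_nat_mult)
    finally show ?thesis
      using that by (simp add: algebra_simps)
  qed
  have "[u * int l + v = u' * int l + v'] (mod int n)"
    using eq by (simp add: uv cong_iff_dvd_diff algebra_simps)
  then have e: "u * int l + v = u' * int l + v'"
    using small bounds by (intro cong_less_imp_eq_int) auto
  have "u = (u * int l + v) div int l" "u' = (u' * int l + v') div int l"
    using bounds by auto
  then have "u = u'"
    using e by metis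
  with e show ?thesis
    by (simp add: uv)
qed

text \<open>A horizontal shift by \<open>n div gcd n l\<close> adds
  \<open>n * (l div gcd n l)\<close> to \<open>i * l + j\<close>, a vertical shift by
  \<open>n\<close> adds \<open>n\<close>; both are multiples of \<open>n\<close>.\<close>

lemma doubly_periodic_dot_array:
  assumes "0 < n"
  shows "doubly_periodic (dot_array n l m a) (n div gcd n l) n"
proof -
  define e where "e = int (n div gcd n l)"
  have "n div gcd n l * l = n * (l div gcd n l)"
    by (metis div_mult_swap dvd_div_mult gcd_dvd1 gcd_dvd2)
  then have e: "e * int l = int n * int (l div gcd n l)"
    unfolding e_def by (metis of_nat_mult)
  have "[x = (i + e) * int l + j] (mod int n) \<longleftrightarrow> [x = i * int l + j] (mod int n)" for x i j
  proof -
    have "(i + e) * int l + j = (i * int l + j) + int (l div gcd n l) * int n"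
      using e by (simp add: algebra_simps)
    then show ?thesis
      by (simp only: cong_def mod_mult_self1)
  qed
  moreover have "[x = i * int l + (j + int n)] (mod int n) \<longleftrightarrow> [x = i * int l + j] (mod int n)"
    for x i j
    by (simp add: cong_def flip: add.assoc)
  moreover have "0 < n div gcd n l"
    using assms by (simp add: div_greater_zero_iff gcd_le1_nat)
  ultimately show ?thesis
    using assms by (auto simp: doubly_periodic_def dot_array_def e_def)
qed

lemma DDC_dot_array_subarray:
  assumes n: "0 < n" and B2: "B2_sequence (integer_mod_group n) m a" and lk: "l * k \<le> n"
  shows "DDC (dot_array n l m a \<inter> subarray l k i0 j0)"
proof -
  let ?S = "dot_array n l m a \<inter> subarray l k i0 j0"
  define f where "f = (\<lambda>(i, j). i * int l + j)"
  have f_diff: "f (x - y) = f x - f y" for x y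
    by (cases x; cases y) (simp add: f_def algebra_simps)
  have f_inj: "x = y" if "x \<in> ?S" "y \<in> ?S" "[f x = f y] (mod int n)" for x y
    using that subarray_inj_mod[OF lk] by (cases x; cases y) (auto simp: f_def)
  have dot: "\<exists>t\<in>{1..m}. [a t = f x] (mod int n)" if "x \<in> ?S" for x
    using that by (cases x) (auto simp: dot_array_def f_def)
  have diff_inj: "x = z \<and> y = w"
    if S: "x \<in> ?S" "y \<in> ?S" "z \<in> ?S" "w \<in> ?S" and ne: "x \<noteq> y" and eq: "x - y = z - w"
    for x y z w
  proof -
    obtain p q r s where t: "p \<in> {1..m}" "q \<in> {1..m}" "r \<in> {1..m}" "s \<in> {1..m}"
      and c: "[a p = f x] (mod int n)" "[a q = f y] (mod int n)"
        "[a r = f z] (mod int n)" "[a s = f w] (mod int n)"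
      using dot S by meson
    have "f x + f w = f z + f y"
      using f_diff[of x y] f_diff[of z w] eq by simp
    then have "[a p + a s = a r + a q] (mod int n)"
      using cong_add[OF c(1) c(4)] cong_add[OF c(3) c(2)] by (simp add: cong_def)
    \<comment> \<open>The alternative to \<open>p = r\<close>, \<open>s = q\<close> is
      \<open>p = q\<close>, \<open>s = r\<close>. There \<open>p = q\<close> alone makes
      \<open>f x\<close> and \<open>f y\<close> congruent, so \<open>x = y\<close>, contrary to
      \<open>x \<noteq> y\<close>.\<close>
    then consider "p = r" "s = q" | "p = q"
      using B2_sequence_cong_sums[OF n B2] t by blast
    then show ?thesis
    proof cases
      case 1
      then show ?thesis
        using c f_inj S by (simp add: cong_def)
    next
      case 2
      then show ?thesis
        using c f_inj[OF S(1,2)] ne by (simp add: cong_def)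
    qed
  qed
  show ?thesis
    unfolding DDC_def
  proof (rule inj_onI)
    fix P Q
    assume "P \<in> {(x, y). x \<in> ?S \<and> y \<in> ?S \<and> x \<noteq> y}" "Q \<in> {(x, y). x \<in> ?S \<and> y \<in> ?S \<and> x \<noteq> y}"
      and "(case P of (x, y) \<Rightarrow> x - y) = (case Q of (x, y) \<Rightarrow> x - y)"
    then show "P = Q"
      using diff_inj[of "fst P" "snd P" "fst Q" "snd Q"]
      by (intro prod.expand) (simp add: case_prod_beta)
  qed
qed

lemma card_dot_array_subarray:
  assumes n: "0 < n" and B2: "B2_sequence (integer_mod_group n) m a"
  shows "card (dot_array n l m a \<inter> subarray n c i0 j0) = m * c"
proof -
  \<comment> \<open>\<open>g (t, i)\<close> is the dot of column \<open>i\<close> that belongs to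
    \<open>a t\<close>: subtracting \<open>j0\<close> before the reduction and adding it afterwards
    puts the row into the window of \<open>n\<close> rows starting at \<open>j0\<close>.\<close>
  define g where "g = (\<lambda>(t, i). (i, j0 + (a t - i * int l - j0) mod int n))"
  have g_cong: "[a t = i * int l + (j0 + (a t - i * int l - j0) mod int n)] (mod int n)" for t i
  proof -
    have "[i * int l + j0 + (a t - i * int l - j0) mod int n
        = i * int l + j0 + (a t - i * int l - j0)] (mod int n)"
      by (intro cong_add cong_refl) (simp add: cong_def)
    then show ?thesis
      by (simp add: cong_sym_eq algebra_simps)
  qed
  have "bij_betw g ({1..m} \<times> {i0..<i0 + int c}) (dot_array n l m a \<inter> subarray n c i0 j0)"
    unfolding bij_betw_def
  proof (intro conjI)
    show "inj_on g ({1..m} \<times> {i0..<i0 + int c})"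
    proof (rule inj_onI, clarsimp simp: g_def)
      fix t u i
      assume t: "Suc 0 \<le> t" "t \<le> m" and u: "Suc 0 \<le> u" "u \<le> m"
        and eq: "(a t - i * int l - j0) mod int n = (a u - i * int l - j0) mod int n"
      have "[a t = a u] (mod int n)"
        using g_cong[of t i] g_cong[of u i] eq by (simp add: cong_def)
      \<comment> \<open>The carrier consists of the least residues, so congruent terms are equal and
        distinct indices give distinct dots.\<close>
      moreover have "a t \<in> {0..<int n}" "a u \<in> {0..<int n}"
        using B2 t u n by (auto simp: B2_sequence_def carrier_integer_mod_group)
      ultimately have "a t = a u"
        by (simp add: cong_def)
      then show "t = u"
        using B2 t u by (auto simp: B2_sequence_def dest: inj_onD)
    qed
    show "g ` ({1..m} \<times> {i0..<i0 + int c}) = dot_array n l m a \<inter> subarray n c i0 j0"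
    proof (intro equalityI subsetI)
      fix x
      assume "x \<in> g ` ({1..m} \<times> {i0..<i0 + int c})"
      then show "x \<in> dot_array n l m a \<inter> subarray n c i0 j0"
        using n g_cong by (force simp: g_def dot_array_def subarray_iff)
    next
      fix x
      assume x: "x \<in> dot_array n l m a \<inter> subarray n c i0 j0"
      obtain i j where ij: "x = (i, j)"
        by (cases x)
      obtain t where t: "t \<in> {1..m}" "[a t = i * int l + j] (mod int n)"
        using x by (auto simp: ij dot_array_def)
      have b: "i0 \<le> i" "i < i0 + int c" "j0 \<le> j" "j < j0 + int n"
        using x by (auto simp: ij subarray_iff)
      have "[a t - i * int l - j0 = j - j0] (mod int n)"
        using t(2) by (simp add: cong_iff_dvd_diff algebra_simps)
      \<comment> \<open>As \<open>0 \<le> j - j0 < int n\<close>, this offset is its own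
        residue.\<close>
      then have "(a t - i * int l - j0) mod int n = j - j0"
        using b by (simp add: cong_def)
      then have "x = g (t, i)"
        by (simp add: g_def ij)
      then show "x \<in> g ` ({1..m} \<times> {i0..<i0 + int c})"
        using t b by auto
    qed
  qed
  then have "card (dot_array n l m a \<inter> subarray n c i0 j0) = card ({1..m} \<times> {i0..<i0 + int c})"
    by (simp add: bij_betw_same_card)
  then show ?thesis
    by (simp add: card_cartesian_product)
qed

theorem theorem14:
  fixes n m l k :: nat and a :: "nat \<Rightarrow> int"
  assumes "0 < n"
    and "B2_sequence (integer_mod_group n) m a"
    and "0 < l" and "0 < k" and "l * k \<le> n"
  shows "doubly_periodic_DDC (dot_array n l m a) l k (n div gcd n l) n \<and>
         has_density (dot_array n l m a) (n div gcd n l) n (real m / real n)"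
proof
  note periodic = doubly_periodic_dot_array[OF assms(1), of l m a]
  show "doubly_periodic_DDC (dot_array n l m a) l k (n div gcd n l) n"
    unfolding doubly_periodic_DDC_def
    using periodic DDC_dot_array_subarray assms by blast
  have "0 < n div gcd n l"
    using periodic by (simp add: doubly_periodic_def)
  then show "has_density (dot_array n l m a) (n div gcd n l) n (real m / real n)"
    unfolding has_density_def
    \<comment> \<open>There are \<open>m\<close> dots in each of the \<open>n div gcd n l\<close>
      columns; this positive factor cancels against the width of the period.\<close>
    by (intro exI[of _ "m * (n div gcd n l)"])
      (simp add: card_dot_array_subarray[OF assms(1,2)])
qed

end
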